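(* Let $\gamma,\alpha\in(0,1)$ and let $(\theta_i,Z_i)_{i\in[m]}$ follow the i.i.d. two-group model described in the context, with ordered local false discovery rates $T^{OR}_{(1)}\le\dots\le T^{OR}_{(m)}$ and $\boldsymbol p^{(k)}=(T^{OR}_{(1)},\dots,T^{OR}_{(k)})$. Let $$K=\max\left\{k\in[m]:\mathbb{P}\left(\mathrm{PBD}(k,\boldsymbol p^{(k)})>\gamma k\right)\le\alpha\right\}$$ be the number of hypotheses rejected along the lfdr ranking by Step 2 of Procedure 1. Define successively (Procedure 2) $$K_1=\max\left\{k\in[m]:\mathbb{E}\left(\sum_{i=1}^k(1-\theta_{(i)})\,\Big|\,\boldsymbol Z\right)\le k\{\alpha+\gamma(1-\alpha)\}\right\},$$ $$K_2=\max\left\{k\in[K_1]:\mathbb{P}(Y_k>\gamma k)\le\alpha\right\},\qquad Y_k\sim\mathrm{Binomial}\left(k,\Big(\prod_{i=1}^kT^{OR}_{(i)}\Big)^{1/k}\right),$$ $$K'=\max\left\{k\in[K_2]:\mathbb{P}\left(\mathrm{PBD}(k,\boldsymbol p^{(k)})>\gamma k\right)\le\alpha\right\},$$ the maximum of an empty set being $0$. Then the two procedures are equivalent: $K'=K$, so both reject exactly the same hypotheses $H^0_{(1)},\dots,H^0_{(K)}$.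
   Context: Two-group model: $[m]=\{1,\dots,m\}$ (and $[0]=\emptyset$); $\theta_1,\dots,\theta_m$ are i.i.d. Bernoulli$(\pi)$ with $\pi=\mathbb{P}(\theta_i=1)$ ($\theta_i=0$ means the $i$-th null hypothesis $H_i^0$ is true). Given $(\theta_i)_{i\in[m]}$, the observations $Z_1,\dots,Z_m$ are independent, and $Z_i$ has density $f_0$ if $\theta_i=0$ and density $f_1$ if $\theta_i=1$. Let $f=(1-\pi)f_0+\pi f_1$, $\boldsymbol Z=(Z_i)_{i\in[m]}$. Local false discovery rate (lfdr): $T_i^{OR}=\mathbb{P}(\theta_i=0\mid Z_i)=(1-\pi)f_0(Z_i)/f(Z_i)$. Order statistics are taken in ascending order (ties broken arbitrarily but in the same way in both procedures), and $\theta_{(i)}$, $H^0_{(i)}$ denote the state and the null hypothesis corresponding to $T^{OR}_{(i)}$. $\mathrm{PBD}(k,\boldsymbol p)$ with $\boldsymbol p=(p_1,\dots,p_k)$ is the Poisson binomial distribution, the law of a sum of $k$ independent Bernoulli variables with success probabilities $p_1,\dots,p_k$. All PBD and binomial tail probabilities above are computed with the realized values $T^{OR}_{(i)}$ held fixed. *)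

theory Defs
  imports "HOL-Probability.Probability"
begin

text \<open>
  The state \<open>\<theta> i\<close> is boolean: \<open>True\<close> stands for 1 (the null hypothesis is false) and \<open>False\<close> for 0
  (it is true). The observations take values in the space of the sigma-finite measure \<open>\<nu>\<close>, and
  \<open>f0\<close>, \<open>f1\<close> are densities with respect to \<open>\<nu>\<close> (for real observations, \<open>\<nu> = lborel\<close>).
  Conditioning on \<open>\<theta>\<close> means passing to the conditional measure given \<open>\<theta> = t\<close>, for every vector of
  states \<open>t\<close> of positive probability.
\<close>

locale two_group_model = prob_space M
  for M :: "'a measure" +
  fixes \<nu> :: "'b measure"
    and m :: nat
    and \<pi> :: real
    and f0 f1 :: "'b \<Rightarrow> real"
    and \<theta> :: "nat \<Rightarrow> 'a \<Rightarrow> bool"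
    and Z :: "nat \<Rightarrow> 'a \<Rightarrow> 'b"
  assumes nu: "sigma_finite_measure \<nu>"
    and pi_ge_0: "0 \<le> \<pi>" and pi_le_1: "\<pi> \<le> 1"
    and f0_measurable: "f0 \<in> borel_measurable \<nu>"
    and f1_measurable: "f1 \<in> borel_measurable \<nu>"
    and f0_nonneg: "\<And>z. z \<in> space \<nu> \<Longrightarrow> 0 \<le> f0 z"
    and f1_nonneg: "\<And>z. z \<in> space \<nu> \<Longrightarrow> 0 \<le> f1 z"
    and f0_total: "(\<integral>\<^sup>+z. ennreal (f0 z) \<partial>\<nu>) = 1"
    and f1_total: "(\<integral>\<^sup>+z. ennreal (f1 z) \<partial>\<nu>) = 1"
    and theta_indep: "indep_vars (\<lambda>_. count_space UNIV) \<theta> {1..m}"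
    and theta_distr: "\<And>i. i \<in> {1..m} \<Longrightarrow>
      distr M (count_space UNIV) (\<theta> i) = measure_pmf (bernoulli_pmf \<pi>)"
    and Z_measurable: "\<And>i. i \<in> {1..m} \<Longrightarrow> random_variable \<nu> (Z i)"
    and Z_cond_indep: "\<And>t. prob {\<omega> \<in> space M. \<forall>i\<in>{1..m}. \<theta> i \<omega> = t i} > 0 \<Longrightarrow>
      prob_space.indep_vars (uniform_measure M {\<omega> \<in> space M. \<forall>i\<in>{1..m}. \<theta> i \<omega> = t i})
        (\<lambda>_. \<nu>) Z {1..m}"
    and Z_cond_density: "\<And>t i. prob {\<omega> \<in> space M. \<forall>i\<in>{1..m}. \<theta> i \<omega> = t i} > 0 \<Longrightarrow>
      i \<in> {1..m} \<Longrightarrow>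
      distributed (uniform_measure M {\<omega> \<in> space M. \<forall>i\<in>{1..m}. \<theta> i \<omega> = t i}) \<nu> (Z i)
        (\<lambda>z. ennreal (if t i then f1 z else f0 z))"

definition lfdr :: "real \<Rightarrow> ('b \<Rightarrow> real) \<Rightarrow> ('b \<Rightarrow> real) \<Rightarrow> 'b \<Rightarrow> real" where
  "lfdr \<pi> f0 f1 z = (1 - \<pi>) * f0 z / ((1 - \<pi>) * f0 z + \<pi> * f1 z)"

text \<open>The formula defining \<open>lfdr\<close> is a version of the conditional probability \<open>P(\<theta>\<^sub>i = 0 | Z\<^sub>i)\<close>:\<close>

context two_group_model
begin

lemma theta_measurable: "i \<in> {1..m} \<Longrightarrow> \<theta> i \<in> measurable M (count_space UNIV)"
  using theta_indep unfolding indep_vars_def by auto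

lemma prob_theta:
  assumes i: "i \<in> {1..m}"
  shows "prob {\<omega> \<in> space M. \<theta> i \<omega> = b} = (if b then \<pi> else 1 - \<pi>)"
proof -
  have "prob {\<omega> \<in> space M. \<theta> i \<omega> = b} = measure (distr M (count_space UNIV) (\<theta> i)) {b}"
    using theta_measurable[OF i] by (subst measure_distr) (auto intro!: arg_cong[where f = prob])
  also have "\<dots> = (if b then \<pi> else 1 - \<pi>)"
    using pi_ge_0 pi_le_1 by (simp add: theta_distr[OF i] measure_pmf_single)
  finally show ?thesis .
qed

lemma prob_theta_Z:
  assumes i: "i \<in> {1..m}" and A: "A \<in> sets \<nu>"
  defines "D \<equiv> \<lambda>b. density \<nu> (\<lambda>z. ennreal (if b then f1 z else f0 z))"
  shows "prob {\<omega> \<in> space M. \<theta> i \<omega> = b \<and> Z i \<omega> \<in> A} =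
    (if b then \<pi> else 1 - \<pi>) * measure (D b) A"
proof -
  let ?I = "{1..m}"
  define E where "E t = {\<omega> \<in> space M. \<forall>j\<in>?I. \<theta> j \<omega> = t j}" for t
  define S where "S = {t \<in> ?I \<rightarrow>\<^sub>E (UNIV :: bool set). t i = b}"
  have [measurable]: "\<And>j. j \<in> ?I \<Longrightarrow> \<theta> j \<in> measurable M (count_space UNIV)"
    "\<And>j. j \<in> ?I \<Longrightarrow> Z j \<in> measurable M \<nu>" "A \<in> sets \<nu>"
    using theta_measurable Z_measurable A by auto
  have E_sets [measurable]: "E t \<in> sets M" for t
    unfolding E_def by measurable
  have ZA: "{\<omega> \<in> space M. Z i \<omega> \<in> A} \<in> sets M"
    using i by measurable
  have fin: "finite S"
    unfolding S_def by (rule finite_subset[of _ "?I \<rightarrow>\<^sub>E UNIV"]) (auto intro: finite_PiE)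
  have split: "prob {\<omega> \<in> space M. \<theta> i \<omega> = b \<and> Z i \<omega> \<in> B} =
      (\<Sum>t\<in>S. prob (E t \<inter> {\<omega> \<in> space M. Z i \<omega> \<in> B}))"
    if B: "{\<omega> \<in> space M. Z i \<omega> \<in> B} \<in> sets M" for B
  proof -
    have "{\<omega> \<in> space M. \<theta> i \<omega> = b \<and> Z i \<omega> \<in> B} =
        (\<Union>t\<in>S. E t \<inter> {\<omega> \<in> space M. Z i \<omega> \<in> B})"
    proof (intro equalityI subsetI)
      fix \<omega> assume w: "\<omega> \<in> {\<omega> \<in> space M. \<theta> i \<omega> = b \<and> Z i \<omega> \<in> B}"
      show "\<omega> \<in> (\<Union>t\<in>S. E t \<inter> {\<omega> \<in> space M. Z i \<omega> \<in> B})"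
        using w i by (intro UN_I[of "restrict (\<lambda>j. \<theta> j \<omega>) ?I"]) (auto simp: S_def E_def)
    qed (use i in \<open>auto simp: S_def E_def\<close>)
    moreover have "disjoint_family_on (\<lambda>t. E t \<inter> {\<omega> \<in> space M. Z i \<omega> \<in> B}) S"
    proof (unfold disjoint_family_on_def, intro ballI impI)
      fix s t assume st: "s \<in> S" "t \<in> S" "s \<noteq> t"
      then have "\<exists>j\<in>?I. s j \<noteq> t j"
        unfolding S_def by (blast intro: PiE_ext)
      then show "E s \<inter> {\<omega> \<in> space M. Z i \<omega> \<in> B} \<inter> (E t \<inter> {\<omega> \<in> space M. Z i \<omega> \<in> B}) = {}"
        unfolding E_def by auto
    qed
    ultimately show ?thesis
      using finite_measure_finite_Union[OF fin, of "\<lambda>t. E t \<inter> {\<omega> \<in> space M. Z i \<omega> \<in> B}"] B E_sets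
      by (simp add: image_subset_iff sets.Int del: UN_simps)
  qed
  have each: "prob (E t \<inter> {\<omega> \<in> space M. Z i \<omega> \<in> A}) = prob (E t) * measure (D b) A"
    if t: "t \<in> S" for t
  proof (cases "prob (E t) > 0")
    case True
    have "distributed (uniform_measure M (E t)) \<nu> (Z i)
        (\<lambda>z. ennreal (if t i then f1 z else f0 z))"
      using Z_cond_density[of t i] True i unfolding E_def by blast
    then have "distr (uniform_measure M (E t)) \<nu> (Z i) = D b"
      using t unfolding distributed_def D_def S_def by simp
    then have "measure (D b) A = measure (uniform_measure M (E t)) {\<omega> \<in> space M. Z i \<omega> \<in> A}"
      using i A measure_distr[of "Z i" "uniform_measure M (E t)" \<nu> A]
      by (simp add: vimage_def Int_def conj_commute Z_measurable)
    also have "\<dots> = prob (E t \<inter> {\<omega> \<in> space M. Z i \<omega> \<in> A}) / prob (E t)"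
      using True ZA by (intro measure_uniform_measure) (auto simp: emeasure_eq_measure)
    finally show ?thesis
      using True by simp
  next
    case False
    then have "prob (E t) = 0"
      using measure_nonneg[of M "E t"] by linarith
    moreover have "prob (E t \<inter> {\<omega> \<in> space M. Z i \<omega> \<in> A}) \<le> prob (E t)"
      by (intro finite_measure_mono) auto
    ultimately show ?thesis
      using measure_nonneg[of M "E t \<inter> {\<omega> \<in> space M. Z i \<omega> \<in> A}"] by simp
  qed
  have "prob {\<omega> \<in> space M. \<theta> i \<omega> = b} = (\<Sum>t\<in>S. prob (E t))"
    using split[of UNIV] by (simp add: Int_absorb2 E_def)
  then show ?thesis
    using split[OF ZA] each by (simp add: prob_theta[OF i] flip: sum_distrib_right)
qed

lemma lfdr_measurable: "lfdr \<pi> f0 f1 \<in> borel_measurable \<nu>"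
  using f0_measurable f1_measurable unfolding lfdr_def[abs_def] by measurable

lemma lfdr_bounds:
  assumes "z \<in> space \<nu>"
  shows "0 \<le> lfdr \<pi> f0 f1 z" "lfdr \<pi> f0 f1 z \<le> 1"
  using f0_nonneg[OF assms] f1_nonneg[OF assms] pi_ge_0 pi_le_1
  by (auto simp: lfdr_def divide_le_eq_1 add_nonneg_eq_0_iff less_le)

lemma distr_Z:
  assumes i: "i \<in> {1..m}"
  shows "distr M \<nu> (Z i) = density \<nu> (\<lambda>z. ennreal ((1 - \<pi>) * f0 z + \<pi> * f1 z))"
proof (rule measure_eqI)
  fix A assume "A \<in> sets (distr M \<nu> (Z i))"
  then have A [measurable]: "A \<in> sets \<nu>" by simp
  note [measurable] = f0_measurable f1_measurable
  let ?D = "\<lambda>b. density \<nu> (\<lambda>z. ennreal (if b then f1 z else f0 z))"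
  have D_prob: "prob_space (?D b)" for b
    using f0_total f1_total
    by (cases b; intro prob_spaceI) (simp_all add: emeasure_density cong: nn_integral_cong)
  have meas: "emeasure (?D b) A = ennreal (measure (?D b) A)" for b
    using D_prob[of b] by (simp add: prob_space.finite_measure finite_measure.emeasure_eq_measure)
  have [measurable]: "\<theta> i \<in> measurable M (count_space UNIV)" "Z i \<in> measurable M \<nu>"
    using theta_measurable Z_measurable i by auto
  have un: "{\<omega> \<in> space M. Z i \<omega> \<in> A} =
      {\<omega> \<in> space M. \<theta> i \<omega> = False \<and> Z i \<omega> \<in> A} \<union> {\<omega> \<in> space M. \<theta> i \<omega> = True \<and> Z i \<omega> \<in> A}"
    by auto
  have "emeasure (distr M \<nu> (Z i)) A = ennreal (prob {\<omega> \<in> space M. Z i \<omega> \<in> A})"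
    by (subst emeasure_distr) (auto simp: emeasure_eq_measure intro!: arg_cong[where f = prob])
  also have "prob {\<omega> \<in> space M. Z i \<omega> \<in> A} =
      (1 - \<pi>) * measure (?D False) A + \<pi> * measure (?D True) A"
    using prob_theta_Z[OF i A, of False] prob_theta_Z[OF i A, of True]
    unfolding un by (subst finite_measure_Union) auto
  also have "ennreal \<dots> = ennreal (1 - \<pi>) * emeasure (?D False) A + ennreal \<pi> * emeasure (?D True) A"
    using pi_ge_0 pi_le_1 by (simp only: meas ennreal_mult ennreal_plus measure_nonneg
        mult_nonneg_nonneg diff_ge_0_iff_ge)
  also have "\<dots> = (\<integral>\<^sup>+z. ennreal (1 - \<pi>) * (ennreal (f0 z) * indicator A z) +
      ennreal \<pi> * (ennreal (f1 z) * indicator A z) \<partial>\<nu>)"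
    by (simp add: emeasure_density nn_integral_add nn_integral_cmult)
  also have "\<dots> = (\<integral>\<^sup>+z. ennreal ((1 - \<pi>) * f0 z + \<pi> * f1 z) * indicator A z \<partial>\<nu>)"
    using pi_ge_0 pi_le_1 f0_nonneg f1_nonneg
    by (intro nn_integral_cong) (simp add: ennreal_mult ennreal_plus distrib_right mult.assoc)
  also have "\<dots> = emeasure (density \<nu> (\<lambda>z. ennreal ((1 - \<pi>) * f0 z + \<pi> * f1 z))) A"
    by (simp add: emeasure_density)
  finally show "emeasure (distr M \<nu> (Z i)) A =
      emeasure (density \<nu> (\<lambda>z. ennreal ((1 - \<pi>) * f0 z + \<pi> * f1 z))) A" .
qed simp

lemma lfdr_eq_cond_prob:
  assumes i: "i \<in> {1..m}"
  shows "AE \<omega> in M. real_cond_exp M (vimage_algebra (space M) (Z i) \<nu>)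
    (indicator {\<omega> \<in> space M. \<theta> i \<omega> = False}) \<omega> = lfdr \<pi> f0 f1 (Z i \<omega>)"
proof -
  let ?F = "vimage_algebra (space M) (Z i) \<nu>"
  let ?N = "{\<omega> \<in> space M. \<theta> i \<omega> = False}"
  let ?f = "\<lambda>z. (1 - \<pi>) * f0 z + \<pi> * f1 z"
  note [measurable] = f0_measurable f1_measurable lfdr_measurable
  have [measurable]: "\<theta> i \<in> measurable M (count_space UNIV)" and Z [measurable]: "Z i \<in> measurable M \<nu>"
    using theta_measurable Z_measurable i by auto
  have sub: "subalgebra M ?F"
    unfolding subalgebra_def
    using Z measurable_space[OF Z] by (auto simp: sets_vimage_algebra2 Pi_iff)
  interpret F: finite_measure_subalgebra M ?F
    by standard (rule sub)
  show ?thesis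
  proof (rule F.real_cond_exp_charact)
    fix B assume "B \<in> sets ?F"
    then obtain A where A [measurable]: "A \<in> sets \<nu>" and B: "B = Z i -` A \<inter> space M"
      using measurable_space[OF Z] by (auto simp: sets_vimage_algebra2 Pi_iff)
    have "(\<integral>\<omega>\<in>B. indicator ?N \<omega> \<partial>M) = (\<integral>\<omega>. indicator {\<omega> \<in> space M. \<theta> i \<omega> = False \<and> Z i \<omega> \<in> A} \<omega> \<partial>M)"
      unfolding set_lebesgue_integral_def
      by (intro Bochner_Integration.integral_cong) (auto simp: B indicator_def)
    also have "\<dots> = prob {\<omega> \<in> space M. \<theta> i \<omega> = False \<and> Z i \<omega> \<in> A}"
      by (subst Bochner_Integration.integral_indicator) (auto intro!: arg_cong[where f = prob])
    also have "\<dots> = (1 - \<pi>) * measure (density \<nu> (\<lambda>z. ennreal (f0 z))) A"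
      using prob_theta_Z[OF i A, of False] by simp
    also have "\<dots> = (1 - \<pi>) * (\<integral>z. f0 z * indicator A z \<partial>\<nu>)"
      using f0_nonneg by (subst integral_eq_nn_integral)
        (auto simp: measure_def emeasure_density ennreal_mult ennreal_indicator
          intro!: AE_I2 arg_cong[where f = enn2real] nn_integral_cong split: split_indicator)
    also have "\<dots> = (\<integral>z. (1 - \<pi>) * f0 z * indicator A z \<partial>\<nu>)"
      by (simp add: mult.assoc)
    also have "\<dots> = (\<integral>z. ?f z *\<^sub>R (indicator A z * lfdr \<pi> f0 f1 z) \<partial>\<nu>)"
    proof (rule Bochner_Integration.integral_cong[OF refl])
      fix z assume z: "z \<in> space \<nu>"
      have "?f z * lfdr \<pi> f0 f1 z = (1 - \<pi>) * f0 z"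
        using f0_nonneg[OF z] f1_nonneg[OF z] pi_ge_0 pi_le_1
        by (cases "?f z = 0") (auto simp: lfdr_def add_nonneg_eq_0_iff)
      then show "(1 - \<pi>) * f0 z * indicator A z = ?f z *\<^sub>R (indicator A z * lfdr \<pi> f0 f1 z)"
        by (auto split: split_indicator)
    qed
    also have "\<dots> = (\<integral>z. indicator A z * lfdr \<pi> f0 f1 z \<partial>distr M \<nu> (Z i))"
      unfolding distr_Z[OF i] using f0_nonneg f1_nonneg pi_ge_0 pi_le_1
      by (subst integral_density) auto
    also have "\<dots> = (\<integral>\<omega>. indicator A (Z i \<omega>) * lfdr \<pi> f0 f1 (Z i \<omega>) \<partial>M)"
      by (subst integral_distr) auto
    also have "\<dots> = (\<integral>\<omega>\<in>B. lfdr \<pi> f0 f1 (Z i \<omega>) \<partial>M)"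
      unfolding set_lebesgue_integral_def
      by (intro Bochner_Integration.integral_cong) (auto simp: B split: split_indicator)
    finally show "(\<integral>\<omega>\<in>B. indicator ?N \<omega> \<partial>M) = (\<integral>\<omega>\<in>B. lfdr \<pi> f0 f1 (Z i \<omega>) \<partial>M)" .
  next
    show "integrable M (indicator ?N :: 'a \<Rightarrow> real)"
      by (intro integrable_real_indicator) (auto simp: emeasure_eq_measure)
    have "AE \<omega> in M. norm (lfdr \<pi> f0 f1 (Z i \<omega>)) \<le> 1"
      using lfdr_bounds measurable_space[OF Z] by (intro AE_I2) auto
    then show "integrable M (\<lambda>\<omega>. lfdr \<pi> f0 f1 (Z i \<omega>))"
      by (intro integrable_const_bound) auto
    have "Z i \<in> measurable ?F \<nu>"
      using measurable_space[OF Z] by (intro measurable_vimage_algebra1) auto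
    then show "(\<lambda>\<omega>. lfdr \<pi> f0 f1 (Z i \<omega>)) \<in> borel_measurable ?F"
      by measurable
  qed
qed

end

definition data_vector :: "nat \<Rightarrow> (nat \<Rightarrow> 'a \<Rightarrow> 'b) \<Rightarrow> 'a \<Rightarrow> nat \<Rightarrow> 'b" where
  "data_vector m Z \<omega> = (\<lambda>i\<in>{1..m}. Z i \<omega>)"

definition data_algebra :: "'a measure \<Rightarrow> 'b measure \<Rightarrow> nat \<Rightarrow> (nat \<Rightarrow> 'a \<Rightarrow> 'b) \<Rightarrow> 'a measure" where
  "data_algebra M \<nu> m Z = vimage_algebra (space M) (data_vector m Z) (Pi\<^sub>M {1..m} (\<lambda>_. \<nu>))"

text \<open>
  \<open>r z k\<close> is the index of the hypothesis in position \<open>k\<close> when the data vector is \<open>z\<close>. Ties are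
  broken in an arbitrary way, provided the choice is a measurable function of the data; a choice
  that looks at the unobserved states would change \<open>E(\<theta>\<^bsub>(k)\<^esub> | Z)\<close>.
\<close>

definition ascending_ranking ::
  "'b measure \<Rightarrow> nat \<Rightarrow> ('b \<Rightarrow> real) \<Rightarrow> ((nat \<Rightarrow> 'b) \<Rightarrow> nat \<Rightarrow> nat) \<Rightarrow> bool" where
  "ascending_ranking \<nu> m T r \<longleftrightarrow>
     (\<forall>k\<in>{1..m}. (\<lambda>z. r z k) \<in> measurable (Pi\<^sub>M {1..m} (\<lambda>_. \<nu>)) (count_space UNIV)) \<and>
     (\<forall>z\<in>space (Pi\<^sub>M {1..m} (\<lambda>_. \<nu>)).
        bij_betw (r z) {1..m} {1..m} \<and>
        (\<forall>j\<in>{1..m}. \<forall>k\<in>{1..m}. j \<le> k \<longrightarrow> T (z (r z j)) \<le> T (z (r z k))))"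

definition poisson_binomial_pmf :: "nat \<Rightarrow> (nat \<Rightarrow> real) \<Rightarrow> nat pmf" where
  "poisson_binomial_pmf k p =
     map_pmf (\<lambda>X. \<Sum>i=1..k. of_bool (X i)) (Pi_pmf {1..k} False (\<lambda>i. bernoulli_pmf (p i)))"

definition max_or_0 :: "nat set \<Rightarrow> nat" where
  "max_or_0 A = (if A = {} then 0 else Max A)"

text \<open>
  In the following definitions \<open>p i\<close> is the realized \<open>i\<close>-th smallest local false discovery rate, and
  \<open>e k\<close> is the realized conditional expectation, given the data, of the number of true nulls among
  the first \<open>k\<close> hypotheses of the ranking.
\<close>

definition proc1_K :: "real \<Rightarrow> real \<Rightarrow> nat \<Rightarrow> (nat \<Rightarrow> real) \<Rightarrow> nat" where
  "proc1_K \<gamma> \<alpha> m p = max_or_0 {k \<in> {1..m}.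
     measure_pmf.prob (poisson_binomial_pmf k p) {x. real x > \<gamma> * real k} \<le> \<alpha>}"

definition proc2_K1 :: "real \<Rightarrow> real \<Rightarrow> nat \<Rightarrow> (nat \<Rightarrow> real) \<Rightarrow> nat" where
  "proc2_K1 \<gamma> \<alpha> m e = max_or_0 {k \<in> {1..m}. e k \<le> real k * (\<alpha> + \<gamma> * (1 - \<alpha>))}"

definition proc2_K2 :: "real \<Rightarrow> real \<Rightarrow> nat \<Rightarrow> (nat \<Rightarrow> real) \<Rightarrow> (nat \<Rightarrow> real) \<Rightarrow> nat" where
  "proc2_K2 \<gamma> \<alpha> m e p = max_or_0 {k \<in> {1..proc2_K1 \<gamma> \<alpha> m e}.
     measure_pmf.prob (binomial_pmf k (root k (\<Prod>i=1..k. p i))) {x. real x > \<gamma> * real k} \<le> \<alpha>}"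

definition proc2_K :: "real \<Rightarrow> real \<Rightarrow> nat \<Rightarrow> (nat \<Rightarrow> real) \<Rightarrow> (nat \<Rightarrow> real) \<Rightarrow> nat" where
  "proc2_K \<gamma> \<alpha> m e p = max_or_0 {k \<in> {1..proc2_K2 \<gamma> \<alpha> m e p}.
     measure_pmf.prob (poisson_binomial_pmf k p) {x. real x > \<gamma> * real k} \<le> \<alpha>}"

definition ordered_lfdr ::
  "nat \<Rightarrow> real \<Rightarrow> ('b \<Rightarrow> real) \<Rightarrow> ('b \<Rightarrow> real) \<Rightarrow> ((nat \<Rightarrow> 'b) \<Rightarrow> nat \<Rightarrow> nat) \<Rightarrow>
    (nat \<Rightarrow> 'a \<Rightarrow> 'b) \<Rightarrow> 'a \<Rightarrow> nat \<Rightarrow> real" where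
  "ordered_lfdr m \<pi> f0 f1 r Z \<omega> k = lfdr \<pi> f0 f1 (Z (r (data_vector m Z \<omega>) k) \<omega>)"

definition expected_true_nulls ::
  "'a measure \<Rightarrow> 'b measure \<Rightarrow> nat \<Rightarrow> (nat \<Rightarrow> 'a \<Rightarrow> bool) \<Rightarrow> ((nat \<Rightarrow> 'b) \<Rightarrow> nat \<Rightarrow> nat) \<Rightarrow>
    (nat \<Rightarrow> 'a \<Rightarrow> 'b) \<Rightarrow> 'a \<Rightarrow> nat \<Rightarrow> real" where
  "expected_true_nulls M \<nu> m \<theta> r Z \<omega> k =
     real_cond_exp M (data_algebra M \<nu> m Z)
       (\<lambda>\<omega>'. \<Sum>i=1..k. 1 - of_bool (\<theta> (r (data_vector m Z \<omega>') i) \<omega>')) \<omega>"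

definition rejected :: "((nat \<Rightarrow> 'b) \<Rightarrow> nat \<Rightarrow> nat) \<Rightarrow> (nat \<Rightarrow> 'b) \<Rightarrow> nat \<Rightarrow> nat set" where
  "rejected r z K = r z ` {1..K}"

end

theory Submission
  imports Defs
begin

text \<open>
  Each filter of Procedure 2 is a necessary condition for \<open>P(PBD(k, p) > \<gamma>k) \<le> \<alpha>\<close>, so \<open>K\<close> survives
  all of them. For \<open>K\<^sub>1\<close>: a variable bounded by \<open>k\<close> whose probability of exceeding \<open>\<gamma>k\<close> is at
  most \<open>\<alpha>\<close> has mean at most \<open>\<gamma>k + (1 - \<gamma>)k\<alpha>\<close>, and the conditional expectation of the number of
  true nulls is a.s. the sum of the local false discovery rates. For \<open>K\<^sub>2\<close>: the binomial with the
  geometric mean of the success probabilities is stochastically dominated by the Poisson binomial.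
\<close>

section \<open>Sums of independent Bernoulli variables\<close>

text \<open>The Poisson binomial law over an arbitrary index set: the smoothing argument singles out
  two arbitrary indices, which the ranges \<open>{1..k}\<close> do not permit.\<close>

definition bernoulli_sum_pmf :: "'i set \<Rightarrow> ('i \<Rightarrow> real) \<Rightarrow> nat pmf" where
  "bernoulli_sum_pmf A p =
     map_pmf (\<lambda>X. \<Sum>i\<in>A. of_bool (X i)) (Pi_pmf A False (\<lambda>i. bernoulli_pmf (p i)))"

lemma poisson_binomial_pmf_eq: "poisson_binomial_pmf k p = bernoulli_sum_pmf {1..k} p"
  by (simp add: poisson_binomial_pmf_def bernoulli_sum_pmf_def)

lemma bernoulli_sum_pmf_cong:
  "(\<And>i. i \<in> A \<Longrightarrow> p i = q i) \<Longrightarrow> bernoulli_sum_pmf A p = bernoulli_sum_pmf A q"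
  unfolding bernoulli_sum_pmf_def by (intro arg_cong2[where f = map_pmf] Pi_pmf_cong) auto

lemma bernoulli_sum_pmf_const:
  assumes "finite A" "0 \<le> g" "g \<le> 1"
  shows "bernoulli_sum_pmf A (\<lambda>_. g) = binomial_pmf (card A) g"
  using assms
  by (subst binomial_pmf_altdef'[of A "card A" g False])
    (simp_all add: bernoulli_sum_pmf_def Collect_conj_eq)

lemma bernoulli_sum_pmf_insert:
  assumes "finite A" "a \<notin> A"
  shows "bernoulli_sum_pmf (insert a A) p =
    bernoulli_pmf (p a) \<bind> (\<lambda>b. map_pmf (\<lambda>n. n + of_bool b) (bernoulli_sum_pmf A p))"
proof -
  have "(\<Sum>i\<in>insert a A. of_bool ((X(a := b)) i)) = (\<Sum>i\<in>A. of_bool (X i)) + (of_bool b :: nat)" for X b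
    using assms by (subst sum.insert) (auto simp del: sum_of_bool_eq intro!: sum.cong)
  then show ?thesis
    unfolding bernoulli_sum_pmf_def Pi_pmf_insert'[OF assms] map_pmf_def
    by (simp only: bind_assoc_pmf bind_return_pmf)
qed

lemma prob_bernoulli_sum_pmf_insert:
  assumes "finite A" "a \<notin> A" "0 \<le> p a" "p a \<le> 1"
  shows "measure_pmf.prob (bernoulli_sum_pmf (insert a A) p) S =
    p a * measure_pmf.prob (bernoulli_sum_pmf A p) {n. n + 1 \<in> S} +
    (1 - p a) * measure_pmf.prob (bernoulli_sum_pmf A p) S"
proof -
  have "ennreal (measure_pmf.prob (bernoulli_sum_pmf (insert a A) p) S) =
    ennreal (p a * measure_pmf.prob (bernoulli_sum_pmf A p) {n. n + 1 \<in> S} +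
    (1 - p a) * measure_pmf.prob (bernoulli_sum_pmf A p) S)"
    using assms
    by (simp add: bernoulli_sum_pmf_insert vimage_def ennreal_mult ennreal_plus mult.commute
        flip: measure_pmf.emeasure_eq_measure)
  then show ?thesis
    using assms by (subst (asm) ennreal_inj) auto
qed

text \<open>Conditioning on the variables at \<open>a\<close> and \<open>b\<close> gives a tail
  probability \<open>Uj\<close> for \<open>j\<close> successes among these two. Grouping the terms
  shows that \<open>p a\<close> and \<open>p b\<close> enter only through their product and their
  sum, and that the coefficient of the sum is nonnegative. The \<open>Uj\<close> depend on the
  values on \<open>A\<close> alone, so a vector and its smoothed version share them.\<close>

lemma tail_bernoulli_sum_pmf_insert2:
  assumes "finite A" "a \<notin> A" "b \<notin> A" "a \<noteq> b"
  obtains U0 U1 U2 where "U0 \<le> U1"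
    "\<And>p. (\<And>i. i \<in> A \<Longrightarrow> p i = q i) \<Longrightarrow> p a \<in> {0..1} \<Longrightarrow> p b \<in> {0..1} \<Longrightarrow>
      measure_pmf.prob (bernoulli_sum_pmf (insert a (insert b A)) p) {n. real n > c} =
      p a * p b * (U2 - 2 * U1 + U0) + (p a + p b) * (U1 - U0) + U0"
proof
  let ?U = "\<lambda>j. measure_pmf.prob (bernoulli_sum_pmf A q) {n. real (n + j) > c}"
  show "?U 0 \<le> ?U 1"
    by (intro measure_pmf.finite_measure_mono) auto
  fix p assume p: "\<And>i. i \<in> A \<Longrightarrow> p i = q i" "p a \<in> {0..1}" "p b \<in> {0..1}"
  have "bernoulli_sum_pmf A p = bernoulli_sum_pmf A q"
    using p(1) by (rule bernoulli_sum_pmf_cong)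
  then show "measure_pmf.prob (bernoulli_sum_pmf (insert a (insert b A)) p) {n. real n > c} =
      p a * p b * (?U 2 - 2 * ?U 1 + ?U 0) + (p a + p b) * (?U 1 - ?U 0) + ?U 0"
    using assms p(2,3) by (simp add: prob_bernoulli_sum_pmf_insert algebra_simps)
qed

text \<open>
  Smoothing: while some success probability differs from the geometric mean \<open>g\<close>, there are
  \<open>p a < g < p b\<close>. Replacing this pair by \<open>g\<close> and \<open>p a * p b / g\<close> keeps the product, and it
  lowers the sum because \<open>(p b - g) * (g - p a) \<ge> 0\<close>; by the previous lemma the tail does not grow.
\<close>

lemma tail_binomial_le_tail_bernoulli_sum:
  assumes "finite A" "g > 0" "\<And>i. i \<in> A \<Longrightarrow> 0 < p i \<and> p i \<le> 1" "(\<Prod>i\<in>A. p i) = g ^ card A"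
  shows "measure_pmf.prob (bernoulli_sum_pmf A (\<lambda>_. g)) {n. real n > c} \<le>
    measure_pmf.prob (bernoulli_sum_pmf A p) {n. real n > c}"
  using assms(3,4)
proof (induction "card {i \<in> A. p i \<noteq> g}" arbitrary: p rule: less_induct)
  case less
  show ?case
  proof (cases "\<forall>i\<in>A. p i = g")
    case True
    then have "bernoulli_sum_pmf A p = bernoulli_sum_pmf A (\<lambda>_. g)"
      by (intro bernoulli_sum_pmf_cong) auto
    then show ?thesis by simp
  next
    case False
    \<comment> \<open>Otherwise all factors are at least \<open>g\<close> and one is larger, so the
      product would exceed \<open>g ^ card A\<close>. The existence of \<open>b\<close> is
      symmetric.\<close>
    have "\<exists>a\<in>A. p a < g"
    proof (rule ccontr)
      assume *: "\<not> ?thesis"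
      then obtain i where "i \<in> A" "g < p i"
        using False by force
      then have "prod (\<lambda>_. g) A < prod p A"
        using * assms(1,2) less.prems(1) by (intro prod_mono_strict[of i]) force+
      then show False using less.prems(2) by simp
    qed
    then obtain a where a: "a \<in> A" "p a < g" by blast
    have "\<exists>b\<in>A. p b > g"
    proof (rule ccontr)
      assume *: "\<not> ?thesis"
      then obtain i where "i \<in> A" "p i < g"
        using False by force
      then have "prod p A < prod (\<lambda>_. g) A"
        using * assms(1,2) less.prems(1) by (intro prod_mono_strict[of i]) force+
      then show False using less.prems(2) by simp
    qed
    then obtain b where b: "b \<in> A" "p b > g" by blast
    define B where "B = A - {a, b}"
    have B: "finite B" "a \<notin> B" "b \<notin> B" "a \<noteq> b" "A = insert a (insert b B)"
      using a b assms(1) by (auto simp: B_def)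
    define q where "q = p(a := g, b := p a * p b / g)"
    have q: "q a = g" "q b = p a * p b / g" "\<And>i. i \<in> B \<Longrightarrow> q i = p i"
      using B by (auto simp: q_def)
    have pa: "0 < p a" "p a \<le> 1" and pb: "0 < p b" "p b \<le> 1"
      using less.prems(1) a b by auto
    \<comment> \<open>The new value is again a probability: \<open>p a < g\<close> and
      \<open>p b \<le> 1\<close> give \<open>p a * p b \<le> g\<close>.\<close>
    have qb: "0 < q b" "q b \<le> 1"
    proof -
      show "0 < q b" using pa pb assms(2) q by simp
      have "p a * p b \<le> g * 1"
        using pa pb a(2) assms(2) by (intro mult_mono) auto
      then show "q b \<le> 1" using assms(2) q by (simp add: divide_le_eq)
    qed
    have ab: "q a * q b = p a * p b"
      using assms(2) q by simp
    \<comment> \<open>For the index \<open>a\<close>, the bound \<open>g \<le> 1\<close> comes from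
      \<open>g < p b\<close> and \<open>p b \<le> 1\<close>.\<close>
    have q01: "0 < q i \<and> q i \<le> 1" if "i \<in> A" for i
      using that B(5) qb q(1) q(3)[of i] a(2) b(2) pb(2) assms(2) less.prems(1)[of i]
      by (cases "i = a \<or> i = b") auto
    have "prod q A = (q a * q b) * prod q B" "prod p A = (p a * p b) * prod p B"
      using B by (simp_all add: mult.assoc)
    then have prod: "prod q A = g ^ card A"
      using ab q(3) less.prems(2) by simp
    \<comment> \<open>The index \<open>a\<close> leaves the set, and \<open>b\<close> belonged to it
      already, so it does not matter whether \<open>q b\<close> equals \<open>g\<close>.\<close>
    have "{i \<in> A. q i \<noteq> g} \<subset> {i \<in> A. p i \<noteq> g}"
      using a b q B(4,5) by (auto simp: q_def)
    then have "card {i \<in> A. q i \<noteq> g} < card {i \<in> A. p i \<noteq> g}"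
      using assms(1) by (intro psubset_card_mono) auto
    from less.hyps[OF this q01 prod]
    have "measure_pmf.prob (bernoulli_sum_pmf A (\<lambda>_. g)) {n. real n > c} \<le>
        measure_pmf.prob (bernoulli_sum_pmf A q) {n. real n > c}" .
    also have "\<dots> \<le> measure_pmf.prob (bernoulli_sum_pmf A p) {n. real n > c}"
    proof -
      obtain U0 U1 U2 where U: "U0 \<le> U1"
        "\<And>p'. (\<And>i. i \<in> B \<Longrightarrow> p' i = p i) \<Longrightarrow> p' a \<in> {0..1} \<Longrightarrow> p' b \<in> {0..1} \<Longrightarrow>
          measure_pmf.prob (bernoulli_sum_pmf A p') {n. real n > c} =
          p' a * p' b * (U2 - 2 * U1 + U0) + (p' a + p' b) * (U1 - U0) + U0"
        using tail_bernoulli_sum_pmf_insert2[OF B(1-4), of p c] unfolding B(5) by blast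
      have "0 \<le> (p b - g) * (g - p a)"
        using a b by simp
      also have "\<dots> = g * ((p a + p b) - (q a + q b))"
        using assms(2) q by (simp add: field_simps)
      finally have "q a + q b \<le> p a + p b"
        using assms(2) by (simp add: zero_le_mult_iff)
      then have "(q a + q b) * (U1 - U0) \<le> (p a + p b) * (U1 - U0)"
        using U(1) by (intro mult_right_mono) auto
      then show ?thesis
        using U(2)[of p] U(2)[of q] q(3) ab pa pb q01[OF a(1)] qb by simp
    qed
    finally show ?thesis .
  qed
qed

lemma tail_binomial_root_le_tail_poisson_binomial:
  assumes "k \<ge> 1" "c \<ge> 0" "\<And>i. i \<in> {1..k} \<Longrightarrow> 0 \<le> p i \<and> p i \<le> 1"
  shows "measure_pmf.prob (binomial_pmf k (root k (\<Prod>i=1..k. p i))) {n. real n > c} \<le>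
    measure_pmf.prob (poisson_binomial_pmf k p) {n. real n > c}"
proof (cases "\<exists>i\<in>{1..k}. p i = 0")
  \<comment> \<open>Smoothing divides by the geometric mean, so a vanishing factor is treated apart:
    the binomial law is then concentrated at 0, and its tail above \<open>c \<ge> 0\<close> is
    zero.\<close>
  case True
  then have "root k (\<Prod>i=1..k. p i) = 0"
    using assms(1) by (auto simp: prod_zero)
  then have "measure_pmf.prob (binomial_pmf k (root k (\<Prod>i=1..k. p i))) {n. real n > c} = 0"
    using assms(2) by (simp add: measure_pmf_zero_iff)
  then show ?thesis by simp
next
  case False
  define g where "g = root k (\<Prod>i=1..k. p i)"
  have pos: "0 < p i \<and> p i \<le> 1" if "i \<in> {1..k}" for i
    using False assms(3)[OF that] that by (metis less_le)
  then have P: "0 < (\<Prod>i=1..k. p i)" "(\<Prod>i=1..k. p i) \<le> 1"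
    by (auto intro!: prod_pos prod_le_1 simp: less_imp_le)
  have g: "0 < g" "g \<le> 1" "g ^ k = (\<Prod>i=1..k. p i)"
    using P assms(1) by (auto simp: g_def)
  have "measure_pmf.prob (bernoulli_sum_pmf {1..k} (\<lambda>_. g)) {n. real n > c} \<le>
      measure_pmf.prob (bernoulli_sum_pmf {1..k} p) {n. real n > c}"
    using g pos by (intro tail_binomial_le_tail_bernoulli_sum) auto
  then show ?thesis
    using g by (simp add: bernoulli_sum_pmf_const poisson_binomial_pmf_eq g_def)
qed

section \<open>Mean and tail of the Poisson binomial law\<close>

lemma set_poisson_binomial_pmf: "x \<in> set_pmf (poisson_binomial_pmf k p) \<Longrightarrow> x \<le> k"
proof -
  assume "x \<in> set_pmf (poisson_binomial_pmf k p)"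
  then obtain X :: "nat \<Rightarrow> bool" where "x = (\<Sum>i=1..k. of_bool (X i))"
    by (auto simp: poisson_binomial_pmf_def)
  also have "\<dots> \<le> (\<Sum>i=1..k. 1)"
    by (intro sum_mono) auto
  finally show ?thesis by simp
qed

lemma expectation_poisson_binomial_pmf:
  assumes "\<And>i. i \<in> {1..k} \<Longrightarrow> 0 \<le> p i \<and> p i \<le> 1"
  shows "measure_pmf.expectation (poisson_binomial_pmf k p) real = (\<Sum>i=1..k. p i)"
proof -
  let ?P = "Pi_pmf {1..k} False (\<lambda>i. bernoulli_pmf (p i))"
  have "measure_pmf.expectation (poisson_binomial_pmf k p) real =
      measure_pmf.expectation ?P (\<lambda>X. \<Sum>i=1..k. of_bool (X i))"
    by (simp add: poisson_binomial_pmf_def)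
  also have "\<dots> = (\<Sum>i=1..k. measure_pmf.expectation ?P (\<lambda>X. of_bool (X i)))"
    by (intro Bochner_Integration.integral_sum measure_pmf.integrable_const_bound[where B = 1]) auto
  also have "\<dots> = (\<Sum>i=1..k. p i)"
  proof (rule sum.cong[OF refl])
    fix i assume i: "i \<in> {1..k}"
    have "measure_pmf.expectation ?P (\<lambda>X. of_bool (X i)) =
        measure_pmf.expectation (map_pmf (\<lambda>X. X i) ?P) (of_bool :: bool \<Rightarrow> real)"
      by simp
    also have "\<dots> = p i"
      using i assms[OF i] by (subst Pi_pmf_component) auto
    finally show "measure_pmf.expectation ?P (\<lambda>X. of_bool (X i)) = p i" .
  qed
  finally show ?thesis .
qed

lemma sum_le_of_tail_poisson_binomial_le:
  assumes p: "\<And>i. i \<in> {1..k} \<Longrightarrow> 0 \<le> p i \<and> p i \<le> 1" and \<gamma>: "0 \<le> \<gamma>" "\<gamma> \<le> 1"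
    and tail: "measure_pmf.prob (poisson_binomial_pmf k p) {x. real x > \<gamma> * real k} \<le> \<alpha>"
  shows "(\<Sum>i=1..k. p i) \<le> real k * (\<alpha> + \<gamma> * (1 - \<alpha>))"
proof -
  let ?P = "poisson_binomial_pmf k p"
  let ?S = "{x. real x > \<gamma> * real k}"
  have "(\<Sum>i=1..k. p i) = measure_pmf.expectation ?P real"
    using expectation_poisson_binomial_pmf[OF p] by simp
  \<comment> \<open>Pointwise majorant: a value is at most \<open>\<gamma> * k\<close> off the tail
    event, and at most \<open>k\<close>, the upper end of the support, on it.\<close>
  also have "\<dots> \<le> measure_pmf.expectation ?P (\<lambda>x. \<gamma> * k + (1 - \<gamma>) * k * indicator ?S x)"
  proof (rule integral_mono_AE)
    show "integrable (measure_pmf ?P) real"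
      using set_poisson_binomial_pmf[of _ k p]
      by (intro measure_pmf.integrable_const_bound[where B = k]) (auto simp: AE_measure_pmf_iff)
    show "AE x in ?P. real x \<le> \<gamma> * k + (1 - \<gamma>) * k * indicator ?S x"
      using set_poisson_binomial_pmf[of _ k p]
      by (auto simp: AE_measure_pmf_iff algebra_simps split: split_indicator)
  qed (auto intro!: integrable_real_indicator simp: measure_pmf.emeasure_eq_measure)
  also have "\<dots> = \<gamma> * k + (1 - \<gamma>) * k * measure_pmf.prob ?P ?S"
    by (subst Bochner_Integration.integral_add)
      (auto intro!: integrable_real_indicator simp: measure_pmf.emeasure_eq_measure)
  also have "\<dots> \<le> \<gamma> * k + (1 - \<gamma>) * k * \<alpha>"
    using tail \<gamma> by (intro add_left_mono mult_left_mono) auto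
  also have "\<dots> = real k * (\<alpha> + \<gamma> * (1 - \<alpha>))"
    by (simp add: algebra_simps)
  finally show ?thesis .
qed

section \<open>Equivalence of the procedures for realized values\<close>

lemma max_or_0_ge: "finite A \<Longrightarrow> k \<in> A \<Longrightarrow> k \<le> max_or_0 A"
  by (auto simp: max_or_0_def)

lemma max_or_0_in: "finite A \<Longrightarrow> max_or_0 A = 0 \<or> max_or_0 A \<in> A"
  by (auto simp: max_or_0_def dest: Max_in)

text \<open>Every element of \<open>A\<close> is at most \<open>max_or_0 A\<close>, hence at most
  \<open>n\<close>, so the truncation removes nothing.\<close>

lemma max_or_0_restrict:
  assumes "finite A" "max_or_0 A \<le> n"
  shows "max_or_0 {k \<in> A. k \<le> n} = max_or_0 A"
  using max_or_0_ge[OF assms(1)] assms(2)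
  by (metis (mono_tags, lifting) Collect_cong Collect_mem_eq order_trans)

text \<open>The deterministic core. All that is needed from the probability model is the hypothesis
  on \<open>e\<close>, which will hold almost surely.\<close>

lemma proc2_K_eq_proc1_K:
  assumes \<gamma>: "0 \<le> \<gamma>" "\<gamma> \<le> 1"
    and p: "\<And>i. i \<in> {1..m} \<Longrightarrow> 0 \<le> p i \<and> p i \<le> 1"
    and e: "\<And>k. k \<in> {1..m} \<Longrightarrow> e k = (\<Sum>i=1..k. p i)"
  shows "proc2_K \<gamma> \<alpha> m e p = proc1_K \<gamma> \<alpha> m p"
proof -
  let ?Q = "\<lambda>k. measure_pmf.prob (poisson_binomial_pmf k p) {x. real x > \<gamma> * real k} \<le> \<alpha>"
  let ?K = "proc1_K \<gamma> \<alpha> m p" and ?K1 = "proc2_K1 \<gamma> \<alpha> m e" and ?K2 = "proc2_K2 \<gamma> \<alpha> m e p"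
  have "?K1 \<le> m"
    using max_or_0_in[of "{k \<in> {1..m}. e k \<le> real k * (\<alpha> + \<gamma> * (1 - \<alpha>))}"]
    unfolding proc2_K1_def by auto
  moreover have "?K2 \<le> ?K1"
    using max_or_0_in[of "{k \<in> {1..?K1}. measure_pmf.prob (binomial_pmf k (root k (\<Prod>i=1..k. p i)))
      {x. real x > \<gamma> * real k} \<le> \<alpha>}"]
    unfolding proc2_K2_def by auto
  \<comment> \<open>The last search set of Procedure 2 is that of Procedure 1 cut off at
    \<open>?K2\<close>, so it remains to see that the cut lies at or above
    \<open>?K\<close>.\<close>
  ultimately have "{k \<in> {1..?K2}. ?Q k} = {k \<in> {k \<in> {1..m}. ?Q k}. k \<le> ?K2}"
    by auto
  \<comment> \<open>The filters have to be checked only at \<open>k = ?K\<close>: since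
    \<open>?K1\<close> and \<open>?K2\<close> are maxima, satisfying their conditions within range
    bounds \<open>?K\<close> by them, even if their search sets have gaps.\<close>
  moreover have "?K \<le> ?K2"
  proof (cases "?K = 0")
    case False
    \<comment> \<open>A nonzero value is not the default 0 of an empty set, so the maximum is
      attained.\<close>
    then have K: "?K \<in> {1..m}" "?Q ?K"
      using max_or_0_in[of "{k \<in> {1..m}. ?Q k}"] unfolding proc1_K_def by auto
    have pK: "0 \<le> p i \<and> p i \<le> 1" if "i \<in> {1..?K}" for i
      using p[of i] that K(1) by auto
    have "e ?K \<le> real ?K * (\<alpha> + \<gamma> * (1 - \<alpha>))"
      using sum_le_of_tail_poisson_binomial_le[OF pK \<gamma> K(2)] e[OF K(1)] by simp
    then have "?K \<le> ?K1"
      unfolding proc2_K1_def using K(1) by (intro max_or_0_ge) auto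
    moreover have "measure_pmf.prob (binomial_pmf ?K (root ?K (\<Prod>i=1..?K. p i)))
        {x. real x > \<gamma> * real ?K} \<le> \<alpha>"
      using tail_binomial_root_le_tail_poisson_binomial[of ?K "\<gamma> * real ?K" p] K pK \<gamma>(1)
      by (auto intro: order_trans)
    ultimately show ?thesis
      unfolding proc2_K2_def using K(1) by (intro max_or_0_ge) auto
  qed simp
  ultimately show ?thesis
    using max_or_0_restrict[of "{k \<in> {1..m}. ?Q k}" ?K2] by (simp add: proc2_K_def proc1_K_def)
qed

section \<open>Conditional expectation of the number of true nulls\<close>

context two_group_model
begin

section \<open>Independence of the pairs of state and observation\<close>

lemma sets_theta_eq [measurable]: "{\<omega> \<in> space M. \<forall>i\<in>{1..m}. \<theta> i \<omega> = t i} \<in> sets M"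
proof -
  have [measurable]: "\<theta> i \<in> measurable M (count_space UNIV)" if "i \<in> {1..m}" for i
    using theta_measurable that .
  show ?thesis by measurable
qed

text \<open>Condition on the full state vector: the event that it equals \<open>t\<close> factors by
  independence of the states, and given this event the observations are independent with the
  densities selected by \<open>t\<close>.\<close>

lemma prob_theta_Z_rect:
  assumes A: "\<And>i. i \<in> {1..m} \<Longrightarrow> A i \<in> sets \<nu>" and m: "m \<noteq> 0"
  shows "prob {\<omega> \<in> space M. \<forall>i\<in>{1..m}. \<theta> i \<omega> = t i \<and> Z i \<omega> \<in> A i} =
    (\<Prod>i\<in>{1..m}. prob {\<omega> \<in> space M. \<theta> i \<omega> = t i \<and> Z i \<omega> \<in> A i})"
proof -
  let ?I = "{1..m}"
  let ?D = "\<lambda>b. density \<nu> (\<lambda>z. ennreal (if b then f1 z else f0 z))"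
  define E where "E = {\<omega> \<in> space M. \<forall>i\<in>?I. \<theta> i \<omega> = t i}"
  \<comment> \<open>With \<open>m\<close> nonzero the index set is nonempty, so this intersection
    lies in \<open>space M\<close>; over an empty index set it would be \<open>UNIV\<close>.\<close>
  define F where "F = (\<Inter>i\<in>?I. Z i -` A i \<inter> space M)"
  have I: "?I \<noteq> {}" "finite ?I"
    using m by auto
  have E: "E \<in> sets M"
    unfolding E_def by (rule sets_theta_eq)
  have ZA: "Z i -` A i \<inter> space M \<in> sets M" if "i \<in> ?I" for i
    using that A Z_measurable by (auto intro: measurable_sets)
  then have F: "F \<in> sets M"
    unfolding F_def using I by (intro sets.finite_INT) auto
  have "prob E = prob (\<Inter>i\<in>?I. \<theta> i -` {t i} \<inter> space M)"
    using m by (intro arg_cong[where f = prob]) (auto simp: E_def)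
  also have "\<dots> = (\<Prod>i\<in>?I. prob (\<theta> i -` {t i} \<inter> space M))"
    using theta_indep I by (intro indep_varsD_finite) auto
  also have "\<dots> = (\<Prod>i\<in>?I. (if t i then \<pi> else 1 - \<pi>))"
    by (intro prod.cong refl, subst prob_theta[symmetric])
      (auto intro!: arg_cong[where f = prob])
  finally have prob_E: "prob E = (\<Prod>i\<in>?I. (if t i then \<pi> else 1 - \<pi>))" .
  have "prob (E \<inter> F) = prob E * (\<Prod>i\<in>?I. measure (?D (t i)) (A i))"
  \<comment> \<open>The model describes the conditional law only for state vectors of positive
    probability; for the others both sides are zero.\<close>
  proof (cases "prob E > 0")
    case True
    let ?U = "uniform_measure M E"
    have pos: "prob {\<omega> \<in> space M. \<forall>i\<in>?I. \<theta> i \<omega> = t i} > 0"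
      using True by (simp add: E_def)
    interpret U: prob_space ?U
      using True by (intro prob_space_uniform_measure) (auto simp: emeasure_eq_measure)
    have "measure ?U F = (\<Prod>i\<in>?I. measure ?U (Z i -` A i \<inter> space ?U))"
      using U.indep_varsD_finite[OF Z_cond_indep[OF pos, folded E_def] I A] by (simp add: F_def)
    also have "\<dots> = (\<Prod>i\<in>?I. measure (?D (t i)) (A i))"
    proof (rule prod.cong[OF refl])
      fix i assume i: "i \<in> ?I"
      have "distributed ?U \<nu> (Z i) (\<lambda>z. ennreal (if t i then f1 z else f0 z))"
        using Z_cond_density[OF pos i] by (simp add: E_def)
      then have "distr ?U \<nu> (Z i) = ?D (t i)"
        by (simp add: distributed_def)
      then show "measure ?U (Z i -` A i \<inter> space ?U) = measure (?D (t i)) (A i)"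
        using measure_distr[of "Z i" ?U \<nu> "A i"] i A Z_measurable by simp
    qed
    finally have "measure ?U F = (\<Prod>i\<in>?I. measure (?D (t i)) (A i))" .
    moreover have "measure ?U F = prob (E \<inter> F) / prob E"
      using True F by (intro measure_uniform_measure) (auto simp: emeasure_eq_measure)
    ultimately show ?thesis
      using True by (simp add: field_simps)
  next
    case False
    then have "prob E = 0"
      using measure_nonneg[of M E] by linarith
    moreover have "prob (E \<inter> F) \<le> prob E"
      using E by (intro finite_measure_mono) auto
    ultimately show ?thesis
      using measure_nonneg[of M "E \<inter> F"] by simp
  qed
  also have "\<dots> = (\<Prod>i\<in>?I. prob {\<omega> \<in> space M. \<theta> i \<omega> = t i \<and> Z i \<omega> \<in> A i})"
    unfolding prob_E prod.distrib[symmetric] using A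
    by (intro prod.cong refl) (simp add: prob_theta_Z)
  also have "E \<inter> F = {\<omega> \<in> space M. \<forall>i\<in>?I. \<theta> i \<omega> = t i \<and> Z i \<omega> \<in> A i}"
    using m by (auto simp: E_def F_def)
  finally show ?thesis .
qed

text \<open>Split the event according to the state vector, apply the rectangle formula to each
  piece, and turn the sum of products into a product of sums. Vectors are taken in
  \<open>PiE\<close>, fixed outside the index range, so that distinct ones differ at some index and
  the pieces are disjoint.\<close>

lemma theta_Z_pairs_indep:
  assumes A: "\<And>i. i \<in> {1..m} \<Longrightarrow> A i \<in> sets \<nu>" and m: "m \<noteq> 0"
  shows "prob {\<omega> \<in> space M. \<forall>i\<in>{1..m}. \<theta> i \<omega> \<in> B i \<and> Z i \<omega> \<in> A i} =
    (\<Prod>i\<in>{1..m}. prob {\<omega> \<in> space M. \<theta> i \<omega> \<in> B i \<and> Z i \<omega> \<in> A i})"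
proof -
  let ?I = "{1..m}"
  let ?G = "\<lambda>t. {\<omega> \<in> space M. \<forall>i\<in>?I. \<theta> i \<omega> = t i \<and> Z i \<omega> \<in> A i}"
  have ZA: "{\<omega> \<in> space M. \<theta> i \<omega> = b \<and> Z i \<omega> \<in> A i} \<in> sets M" if "i \<in> ?I" for i b
  proof -
    have [measurable]: "\<theta> i \<in> measurable M (count_space UNIV)" "Z i \<in> measurable M \<nu>" "A i \<in> sets \<nu>"
      using that theta_measurable Z_measurable A by auto
    show ?thesis by measurable
  qed
  have G: "?G t \<in> sets M" for t
  proof -
    have "?G t = {\<omega> \<in> space M. \<forall>i\<in>?I. \<omega> \<in> {\<omega> \<in> space M. \<theta> i \<omega> = t i \<and> Z i \<omega> \<in> A i}}"
      by auto
    also have "\<dots> \<in> sets M"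
      using ZA m by (intro sets.sets_Collect_finite_All') (auto simp: Suc_le_eq)
    finally show ?thesis .
  qed
  have fin: "finite (PiE ?I B)"
    by (intro finite_PiE) auto
  have "{\<omega> \<in> space M. \<forall>i\<in>?I. \<theta> i \<omega> \<in> B i \<and> Z i \<omega> \<in> A i} = (\<Union>t\<in>PiE ?I B. ?G t)"
  proof (intro equalityI subsetI)
    fix \<omega> assume "\<omega> \<in> {\<omega> \<in> space M. \<forall>i\<in>?I. \<theta> i \<omega> \<in> B i \<and> Z i \<omega> \<in> A i}"
    then show "\<omega> \<in> (\<Union>t\<in>PiE ?I B. ?G t)"
      by (intro UN_I[of "restrict (\<lambda>j. \<theta> j \<omega>) ?I"]) auto
  qed (auto simp: PiE_iff)
  moreover have "disjoint_family_on ?G (PiE ?I B)"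
  proof (unfold disjoint_family_on_def, intro ballI impI)
    fix s t assume "s \<in> PiE ?I B" "t \<in> PiE ?I B" "s \<noteq> t"
    then have "\<exists>j\<in>?I. s j \<noteq> t j"
      by (blast intro: PiE_ext)
    then show "?G s \<inter> ?G t = {}" by auto
  qed
  ultimately have "prob {\<omega> \<in> space M. \<forall>i\<in>?I. \<theta> i \<omega> \<in> B i \<and> Z i \<omega> \<in> A i} =
      (\<Sum>t\<in>PiE ?I B. prob (?G t))"
    using finite_measure_finite_Union[OF fin, of ?G] G by (simp add: image_subset_iff)
  also have "\<dots> = (\<Sum>t\<in>PiE ?I B. \<Prod>i\<in>?I. prob {\<omega> \<in> space M. \<theta> i \<omega> = t i \<and> Z i \<omega> \<in> A i})"
    using prob_theta_Z_rect[OF A m] by simp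
  also have "\<dots> = (\<Prod>i\<in>?I. \<Sum>b\<in>B i. prob {\<omega> \<in> space M. \<theta> i \<omega> = b \<and> Z i \<omega> \<in> A i})"
    by (rule prod_sum_PiE[symmetric]) auto
  also have "\<dots> = (\<Prod>i\<in>?I. prob {\<omega> \<in> space M. \<theta> i \<omega> \<in> B i \<and> Z i \<omega> \<in> A i})"
  proof (rule prod.cong[OF refl])
    fix i assume i: "i \<in> ?I"
    let ?H = "\<lambda>b. {\<omega> \<in> space M. \<theta> i \<omega> = b \<and> Z i \<omega> \<in> A i}"
    have "{\<omega> \<in> space M. \<theta> i \<omega> \<in> B i \<and> Z i \<omega> \<in> A i} = (\<Union>b\<in>B i. ?H b)"
      by auto
    moreover have "prob (\<Union>b\<in>B i. ?H b) = (\<Sum>b\<in>B i. prob (?H b))"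
      using ZA[OF i] by (intro finite_measure_finite_Union) (auto simp: disjoint_family_on_def)
    ultimately show "(\<Sum>b\<in>B i. prob {\<omega> \<in> space M. \<theta> i \<omega> = b \<and> Z i \<omega> \<in> A i}) =
        prob {\<omega> \<in> space M. \<theta> i \<omega> \<in> B i \<and> Z i \<omega> \<in> A i}"
      by simp
  qed
  finally show ?thesis .
qed

text \<open>Unconditional independence of the observations, obtained from that of the pairs by
  leaving all states free.\<close>

lemma Z_indep: "indep_vars (\<lambda>_. \<nu>) Z {1..m}"
proof (cases "m = 0")
  case True
  then show ?thesis
    by (simp add: indep_vars_def indep_sets_def)
next
  case False
  show ?thesis
  proof (subst indep_vars_finite[where E = "\<lambda>_. sets \<nu>"])
    show "\<forall>A\<in>{1..m} \<rightarrow> sets \<nu>. prob (\<Inter>j\<in>{1..m}. Z j -` A j \<inter> space M) =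
        (\<Prod>j\<in>{1..m}. prob (Z j -` A j \<inter> space M))"
    proof
      fix A assume "A \<in> {1..m} \<rightarrow> sets \<nu>"
      then have "prob {\<omega> \<in> space M. \<forall>i\<in>{1..m}. \<theta> i \<omega> \<in> UNIV \<and> Z i \<omega> \<in> A i} =
          (\<Prod>i\<in>{1..m}. prob {\<omega> \<in> space M. \<theta> i \<omega> \<in> UNIV \<and> Z i \<omega> \<in> A i})"
        using False by (intro theta_Z_pairs_indep) auto
      moreover have "{\<omega> \<in> space M. \<forall>i\<in>{1..m}. \<theta> i \<omega> \<in> UNIV \<and> Z i \<omega> \<in> A i} =
          (\<Inter>j\<in>{1..m}. Z j -` A j \<inter> space M)"
        using False by auto
      moreover have "{\<omega> \<in> space M. \<theta> i \<omega> \<in> UNIV \<and> Z i \<omega> \<in> A i} = Z i -` A i \<inter> space M" for i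
        by auto
      ultimately show "prob (\<Inter>j\<in>{1..m}. Z j -` A j \<inter> space M) =
          (\<Prod>j\<in>{1..m}. prob (Z j -` A j \<inter> space M))"
        by simp
    qed
  qed (use False Z_measurable sets.space_closed in
      \<open>auto simp: sets.sigma_sets_eq sets.Int_stable\<close>)
qed

section \<open>The sigma-algebra generated by the data\<close>

lemma data_vector_measurable: "data_vector m Z \<in> measurable M (Pi\<^sub>M {1..m} (\<lambda>_. \<nu>))"
  unfolding data_vector_def[abs_def] by (intro measurable_restrict Z_measurable)

lemma subalgebra_data: "subalgebra M (data_algebra M \<nu> m Z)"
  unfolding subalgebra_def data_algebra_def
  using measurable_space[OF data_vector_measurable] measurable_sets[OF data_vector_measurable]
  by (auto simp: sets_vimage_algebra2 Pi_iff)

lemma data_vector_measurable_data: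
  "data_vector m Z \<in> measurable (data_algebra M \<nu> m Z) (Pi\<^sub>M {1..m} (\<lambda>_. \<nu>))"
  unfolding data_algebra_def
  using measurable_space[OF data_vector_measurable] by (intro measurable_vimage_algebra1) auto

lemma Z_measurable_data:
  assumes "i \<in> {1..m}"
  shows "Z i \<in> measurable (data_algebra M \<nu> m Z) \<nu>"
proof -
  have "(\<lambda>\<omega>. data_vector m Z \<omega> i) \<in> measurable (data_algebra M \<nu> m Z) \<nu>"
    by (rule measurable_compose[OF data_vector_measurable_data measurable_component_singleton[OF assms]])
  then show ?thesis
    using assms by (simp add: data_vector_def)
qed

section \<open>Null probability of one hypothesis given all observations\<close>

lemma nn_integral_lfdr_Z:
  assumes i: "i \<in> {1..m}" and A: "A \<in> sets \<nu>"
  shows "(\<integral>\<^sup>+\<omega>. ennreal (lfdr \<pi> f0 f1 (Z i \<omega>)) * indicator A (Z i \<omega>) \<partial>M) =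
    ennreal (prob {\<omega> \<in> space M. \<theta> i \<omega> = False \<and> Z i \<omega> \<in> A})"
proof -
  note [measurable] = f0_measurable f1_measurable lfdr_measurable A
  have [measurable]: "Z i \<in> measurable M \<nu>"
    using Z_measurable i .
  have "(\<integral>\<^sup>+\<omega>. ennreal (lfdr \<pi> f0 f1 (Z i \<omega>)) * indicator A (Z i \<omega>) \<partial>M) =
      (\<integral>\<^sup>+z. ennreal (lfdr \<pi> f0 f1 z) * indicator A z \<partial>distr M \<nu> (Z i))"
    by (subst nn_integral_distr) auto
  also have "\<dots> = (\<integral>\<^sup>+z. ennreal ((1 - \<pi>) * f0 z + \<pi> * f1 z) *
      (ennreal (lfdr \<pi> f0 f1 z) * indicator A z) \<partial>\<nu>)"
    unfolding distr_Z[OF i] by (subst nn_integral_density) auto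
  also have "\<dots> = (\<integral>\<^sup>+z. ennreal (1 - \<pi>) * (ennreal (f0 z) * indicator A z) \<partial>\<nu>)"
  proof (rule nn_integral_cong)
    fix z assume z: "z \<in> space \<nu>"
    let ?f = "(1 - \<pi>) * f0 z + \<pi> * f1 z"
    have nonneg: "0 \<le> ?f"
      using f0_nonneg[OF z] f1_nonneg[OF z] pi_ge_0 pi_le_1 by simp
    \<comment> \<open>Where the mixture density vanishes, so do both of its nonnegative summands,
      and the equation reads 0 = 0.\<close>
    have "?f * lfdr \<pi> f0 f1 z = (1 - \<pi>) * f0 z"
      using f0_nonneg[OF z] f1_nonneg[OF z] pi_ge_0 pi_le_1
      by (cases "?f = 0") (auto simp: lfdr_def add_nonneg_eq_0_iff)
    then have "ennreal ?f * ennreal (lfdr \<pi> f0 f1 z) = ennreal (1 - \<pi>) * ennreal (f0 z)"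
      using nonneg lfdr_bounds(1)[OF z] f0_nonneg[OF z] pi_le_1 by (simp flip: ennreal_mult)
    then show "ennreal ?f * (ennreal (lfdr \<pi> f0 f1 z) * indicator A z) =
        ennreal (1 - \<pi>) * (ennreal (f0 z) * indicator A z)"
      by (simp flip: mult.assoc)
  qed
  also have "\<dots> = ennreal (1 - \<pi>) * emeasure (density \<nu> (\<lambda>z. ennreal (f0 z))) A"
    by (simp add: nn_integral_cmult emeasure_density)
  also have "emeasure (density \<nu> (\<lambda>z. ennreal (f0 z))) A =
      ennreal (measure (density \<nu> (\<lambda>z. ennreal (f0 z))) A)"
  proof -
    have "prob_space (density \<nu> (\<lambda>z. ennreal (f0 z)))"
      using f0_total by (intro prob_spaceI) (simp add: emeasure_density cong: nn_integral_cong)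
    then show ?thesis
      by (simp add: prob_space.finite_measure finite_measure.emeasure_eq_measure)
  qed
  finally show ?thesis
    using prob_theta_Z[OF i A, of False] pi_le_1 by (simp add: ennreal_mult)
qed

text \<open>
  The lfdr of one hypothesis is its conditional null probability given the whole data vector, not
  only given its own observation: by independence of the pairs \<open>(\<theta>\<^sub>i, Z\<^sub>i)\<close> both sides of the
  defining identity factor over rectangles, with equal factors.
\<close>

lemma emeasure_null_data:
  assumes j: "j \<in> {1..m}" and S: "S \<in> sets (Pi\<^sub>M {1..m} (\<lambda>_. \<nu>))"
  shows "emeasure M {\<omega> \<in> space M. \<theta> j \<omega> = False \<and> data_vector m Z \<omega> \<in> S} =
    (\<integral>\<^sup>+\<omega>. ennreal (lfdr \<pi> f0 f1 (Z j \<omega>)) * indicator S (data_vector m Z \<omega>) \<partial>M)"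
proof -
  let ?I = "{1..m}"
  let ?P = "Pi\<^sub>M ?I (\<lambda>_. \<nu>)"
  let ?l = "\<lambda>\<omega>. ennreal (lfdr \<pi> f0 f1 (Z j \<omega>))"
  let ?N = "\<lambda>\<omega>. if \<theta> j \<omega> then 0 else 1 :: ennreal"
  let ?X = "data_vector m Z"
  let ?\<mu> = "\<lambda>h. distr (density M h) ?P ?X"
  note [measurable] = lfdr_measurable data_vector_measurable
  have [measurable]: "\<And>i. i \<in> ?I \<Longrightarrow> Z i \<in> measurable M \<nu>"
    "Z j \<in> measurable M \<nu>" "\<theta> j \<in> measurable M (count_space UNIV)"
    using theta_measurable Z_measurable j by auto
  have X: "?X \<in> measurable (density M h) ?P" for h
    using data_vector_measurable by simp
  have \<mu>: "emeasure (?\<mu> h) S = (\<integral>\<^sup>+\<omega>. h \<omega> * indicator S (?X \<omega>) \<partial>M)"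
    if [measurable]: "S \<in> sets ?P" "h \<in> borel_measurable M" for h S
  proof -
    have "emeasure (?\<mu> h) S = emeasure (density M h) (?X -` S \<inter> space M)"
      using X that(1) by (subst emeasure_distr) auto
    also have "\<dots> = (\<integral>\<^sup>+\<omega>. h \<omega> * indicator (?X -` S \<inter> space M) \<omega> \<partial>M)"
      by (subst emeasure_density) auto
    also have "\<dots> = (\<integral>\<^sup>+\<omega>. h \<omega> * indicator S (?X \<omega>) \<partial>M)"
      by (intro nn_integral_cong) (auto split: split_indicator)
    finally show ?thesis .
  qed
  have \<mu>N: "emeasure (?\<mu> ?N) S = emeasure M {\<omega> \<in> space M. \<theta> j \<omega> = False \<and> ?X \<omega> \<in> S}"
    if [measurable]: "S \<in> sets ?P" for S
  proof -
    have "emeasure (?\<mu> ?N) S = (\<integral>\<^sup>+\<omega>. ?N \<omega> * indicator S (?X \<omega>) \<partial>M)"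
      by (rule \<mu>[OF that]) measurable
    also have "\<dots> = (\<integral>\<^sup>+\<omega>. indicator {\<omega> \<in> space M. \<theta> j \<omega> = False \<and> ?X \<omega> \<in> S} \<omega> \<partial>M)"
      by (intro nn_integral_cong) (auto split: split_indicator)
    also have "\<dots> = emeasure M {\<omega> \<in> space M. \<theta> j \<omega> = False \<and> ?X \<omega> \<in> S}"
      by (rule nn_integral_indicator) measurable
    finally show ?thesis .
  qed
  \<comment> \<open>As functions of \<open>S\<close>, both sides of the claim are finite measures on
    the product space, images under the data vector of measures with densities \<open>?N\<close> and
    \<open>?l\<close>. It therefore suffices to compare them on rectangles.\<close>
  have "?\<mu> ?N = ?\<mu> ?l"
  proof (rule measure_eqI_PiM_finite[of ?I])
    fix A assume A: "\<And>i. i \<in> ?I \<Longrightarrow> A i \<in> sets \<nu>"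
    have S: "Pi\<^sub>E ?I A \<in> sets ?P"
      using A by (intro sets_PiM_I_finite) auto
    have XA: "?X \<omega> \<in> Pi\<^sub>E ?I A \<longleftrightarrow> (\<forall>i\<in>?I. Z i \<omega> \<in> A i)" for \<omega>
      by (auto simp: data_vector_def PiE_iff)
    \<comment> \<open>Only the state of \<open>j\<close> is constrained, so the rectangle formula
      gives a joint null probability at \<open>j\<close> and plain probabilities of
      \<open>Z i\<close> elsewhere.\<close>
    let ?B = "\<lambda>i. if i = j then {False} else UNIV"
    let ?c = "\<lambda>i. ennreal (prob {\<omega> \<in> space M. \<theta> i \<omega> \<in> ?B i \<and> Z i \<omega> \<in> A i})"
    have "emeasure (?\<mu> ?N) (Pi\<^sub>E ?I A) =
        emeasure M {\<omega> \<in> space M. \<forall>i\<in>?I. \<theta> i \<omega> \<in> ?B i \<and> Z i \<omega> \<in> A i}"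
      unfolding \<mu>N[OF S] XA using j by (intro arg_cong[where f = "emeasure M"]) auto
    also have "\<dots> = (\<Prod>i\<in>?I. ?c i)"
      unfolding emeasure_eq_measure using j A
      by (subst theta_Z_pairs_indep) (auto simp: prod_ennreal)
    also have "\<dots> = (\<Prod>i\<in>?I. \<integral>\<^sup>+\<omega>. (if i = j then ?l \<omega> else 1) * indicator (A i) (Z i \<omega>) \<partial>M)"
    proof (rule prod.cong[OF refl])
      fix i assume i: "i \<in> ?I"
      then have [measurable]: "A i \<in> sets \<nu>" "Z i \<in> measurable M \<nu>"
        using A Z_measurable by auto
      show "?c i = (\<integral>\<^sup>+\<omega>. (if i = j then ?l \<omega> else 1) * indicator (A i) (Z i \<omega>) \<partial>M)"
      proof (cases "i = j")
        case True
        then show ?thesis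
          using nn_integral_lfdr_Z[OF i A[OF i]] by simp
      next
        case False
        have "(\<integral>\<^sup>+\<omega>. indicator (A i) (Z i \<omega>) \<partial>M) =
            (\<integral>\<^sup>+\<omega>. indicator {\<omega> \<in> space M. Z i \<omega> \<in> A i} \<omega> \<partial>M)"
          by (intro nn_integral_cong) (auto split: split_indicator)
        then show ?thesis
          using False by (simp add: emeasure_eq_measure)
      qed
    qed
    also have "\<dots> = (\<Prod>i\<in>?I. \<integral>\<^sup>+\<omega>. (\<lambda>z. (if i = j then ennreal (lfdr \<pi> f0 f1 z) else 1) *
        indicator (A i) z) (Z i \<omega>) \<partial>M)"
      by (intro prod.cong nn_integral_cong) auto
    \<comment> \<open>Each factor is now a function of a single observation, so independence of the
      \<open>Z i\<close> merges the product of integrals into one integral.\<close>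
    also have "\<dots> = (\<integral>\<^sup>+\<omega>. (\<Prod>i\<in>?I. (\<lambda>z. (if i = j then ennreal (lfdr \<pi> f0 f1 z) else 1) *
        indicator (A i) z) (Z i \<omega>)) \<partial>M)"
    proof (rule indep_vars_nn_integral[symmetric])
      show "indep_vars (\<lambda>_. borel) (\<lambda>i \<omega>. (\<lambda>z. (if i = j then ennreal (lfdr \<pi> f0 f1 z) else 1) *
          indicator (A i) z) (Z i \<omega>)) ?I"
        by (rule indep_vars_compose2[OF Z_indep]) (use A in \<open>measurable; auto\<close>)
    qed auto
    also have "\<dots> = (\<integral>\<^sup>+\<omega>. ?l \<omega> * indicator (Pi\<^sub>E ?I A) (?X \<omega>) \<partial>M)"
    proof (rule nn_integral_cong)
      fix \<omega>
      have "(\<Prod>i\<in>?I. indicator (A i) (Z i \<omega>)) = (indicator (Pi\<^sub>E ?I A) (?X \<omega>) :: ennreal)"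
      proof (cases "\<forall>i\<in>?I. Z i \<omega> \<in> A i")
        case True
        then have "(\<Prod>i\<in>?I. indicator (A i) (Z i \<omega>)) = (\<Prod>i\<in>?I. 1 :: ennreal)"
          by (intro prod.cong) auto
        then show ?thesis
          using True XA[of \<omega>] by simp
      next
        case False
        then have "\<exists>i\<in>?I. indicator (A i) (Z i \<omega>) = (0 :: ennreal)"
          by (auto simp: indicator_eq_0_iff)
        then have "(\<Prod>i\<in>?I. indicator (A i) (Z i \<omega>)) = (0 :: ennreal)"
          by (intro prod_zero) auto
        then show ?thesis
          using False XA[of \<omega>] by simp
      qed
      then show "(\<Prod>i\<in>?I. (\<lambda>z. (if i = j then ennreal (lfdr \<pi> f0 f1 z) else 1) *
          indicator (A i) z) (Z i \<omega>)) = ?l \<omega> * indicator (Pi\<^sub>E ?I A) (?X \<omega>)"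
        using j by (simp add: prod.distrib prod.delta if_distrib[of "\<lambda>f. f _"] cong: if_cong)
    qed
    also have "\<dots> = emeasure (?\<mu> ?l) (Pi\<^sub>E ?I A)"
      using S by (subst \<mu>) auto
    finally show "emeasure (?\<mu> ?N) (Pi\<^sub>E ?I A) = emeasure (?\<mu> ?l) (Pi\<^sub>E ?I A)" .
  next
    show "range (\<lambda>_::nat. space ?P) \<subseteq> prod_algebra ?I (\<lambda>_. \<nu>)"
      by (auto simp: space_PiM intro!: prod_algebraI_finite)
    show "emeasure (?\<mu> ?N) (space ?P) \<noteq> \<infinity>"
      by (subst \<mu>N) (auto simp: emeasure_eq_measure)
  qed auto
  then show ?thesis
    using \<mu>N[OF S] \<mu>[OF S, of ?l] by simp
qed

text \<open>The sets of the data sigma-algebra are the preimages of measurable sets of data vectors,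
  so the identity that characterizes the conditional expectation is
  \<open>emeasure_null_data\<close> in terms of real integrals.\<close>

lemma real_cond_exp_null_data:
  assumes j: "j \<in> {1..m}"
  shows "AE \<omega> in M. real_cond_exp M (data_algebra M \<nu> m Z)
    (\<lambda>\<omega>. 1 - of_bool (\<theta> j \<omega>)) \<omega> = lfdr \<pi> f0 f1 (Z j \<omega>)"
proof -
  let ?F = "data_algebra M \<nu> m Z"
  let ?P = "Pi\<^sub>M {1..m} (\<lambda>_. \<nu>)"
  let ?X = "data_vector m Z"
  let ?l = "\<lambda>\<omega>. lfdr \<pi> f0 f1 (Z j \<omega>)"
  note [measurable] = lfdr_measurable data_vector_measurable
  have [measurable]: "Z j \<in> measurable M \<nu>" "\<theta> j \<in> measurable M (count_space UNIV)"
    using theta_measurable Z_measurable j by auto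
  have bounds: "0 \<le> ?l \<omega>" "?l \<omega> \<le> 1" if "\<omega> \<in> space M" for \<omega>
    using that lfdr_bounds measurable_space[of "Z j" M \<nu>] by auto
  interpret F: finite_measure_subalgebra M ?F
    by standard (rule subalgebra_data)
  show ?thesis
  proof (rule F.real_cond_exp_charact)
    fix B assume "B \<in> sets ?F"
    then obtain S where S [measurable]: "S \<in> sets ?P" and B: "B = ?X -` S \<inter> space M"
      using measurable_space[OF data_vector_measurable]
      by (auto simp: data_algebra_def sets_vimage_algebra2 Pi_iff)
    have "(\<integral>\<omega>\<in>B. (1 - of_bool (\<theta> j \<omega>)) \<partial>M) =
        (\<integral>\<omega>. indicator {\<omega> \<in> space M. \<theta> j \<omega> = False \<and> ?X \<omega> \<in> S} \<omega> \<partial>M)"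
      unfolding set_lebesgue_integral_def
      by (intro Bochner_Integration.integral_cong) (auto simp: B indicator_def)
    also have "\<dots> = enn2real (emeasure M {\<omega> \<in> space M. \<theta> j \<omega> = False \<and> ?X \<omega> \<in> S})"
      by (subst Bochner_Integration.integral_indicator)
        (auto simp: measure_def intro!: arg_cong[where f = "\<lambda>S. enn2real (emeasure M S)"])
    also have "\<dots> = enn2real (\<integral>\<^sup>+\<omega>. ennreal (?l \<omega> * indicator S (?X \<omega>)) \<partial>M)"
      unfolding emeasure_null_data[OF j S] using bounds
      by (intro arg_cong[where f = enn2real] nn_integral_cong) (auto split: split_indicator)
    also have "\<dots> = (\<integral>\<omega>. ?l \<omega> * indicator S (?X \<omega>) \<partial>M)"
      using bounds by (subst integral_eq_nn_integral) auto
    also have "\<dots> = (\<integral>\<omega>\<in>B. ?l \<omega> \<partial>M)"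
      unfolding set_lebesgue_integral_def
      by (intro Bochner_Integration.integral_cong) (auto simp: B split: split_indicator)
    finally show "(\<integral>\<omega>\<in>B. (1 - of_bool (\<theta> j \<omega>)) \<partial>M) = (\<integral>\<omega>\<in>B. ?l \<omega> \<partial>M)" .
  next
    show "integrable M (\<lambda>\<omega>. 1 - of_bool (\<theta> j \<omega>) :: real)"
      by (intro integrable_const_bound[where B = 1]) auto
    show "integrable M ?l"
      using bounds by (intro integrable_const_bound[where B = 1]) auto
    show "?l \<in> borel_measurable ?F"
      using measurable_compose[OF Z_measurable_data[OF j] lfdr_measurable] .
  qed
qed

section \<open>The hypotheses in ranked order\<close>

lemma ranking_component_measurable:
  assumes r: "ascending_ranking \<nu> m (lfdr \<pi> f0 f1) r" and i: "i \<in> {1..m}"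
    and X: "X \<in> measurable N (Pi\<^sub>M {1..m} (\<lambda>_. \<nu>))"
  shows "(\<lambda>\<omega>. r (X \<omega>) i) \<in> measurable N (count_space UNIV)"
  using r i by (intro measurable_compose[OF X]) (auto simp: ascending_ranking_def)

lemma ranking_component_in:
  assumes r: "ascending_ranking \<nu> m (lfdr \<pi> f0 f1) r" and i: "i \<in> {1..m}" and \<omega>: "\<omega> \<in> space M"
  shows "r (data_vector m Z \<omega>) i \<in> {1..m}"
  using r i measurable_space[OF data_vector_measurable \<omega>]
  unfolding ascending_ranking_def by (blast dest: bij_betwE)

text \<open>
  The state at position \<open>i\<close> is \<open>\<Sum>j. 1{r(Z) i = j} * \<theta> j\<close>, and the indicators are functions of the
  data, so they can be pulled out of the conditional expectation.
\<close>

lemma real_cond_exp_null_ranked: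
  assumes r: "ascending_ranking \<nu> m (lfdr \<pi> f0 f1) r" and i: "i \<in> {1..m}"
  defines "W \<equiv> \<lambda>\<omega>. 1 - of_bool (\<theta> (r (data_vector m Z \<omega>) i) \<omega>) :: real"
  shows "integrable M W"
    and "AE \<omega> in M. real_cond_exp M (data_algebra M \<nu> m Z) W \<omega> = ordered_lfdr m \<pi> f0 f1 r Z \<omega> i"
proof -
  let ?I = "{1..m}"
  let ?F = "data_algebra M \<nu> m Z"
  let ?X = "data_vector m Z"
  let ?R = "\<lambda>j \<omega>. of_bool (r (?X \<omega>) i = j) :: real"
  \<comment> \<open>The value 0 outside the index range makes the summands integrable for every
    \<open>j\<close>, as the sum rule for conditional expectations asks.\<close>
  let ?N = "\<lambda>j \<omega>. if j \<in> ?I then 1 - of_bool (\<theta> j \<omega>) else 0 :: real"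
  let ?S = "\<lambda>\<omega>. \<Sum>j\<in>?I. ?R j \<omega> * ?N j \<omega>"
  interpret F: finite_measure_subalgebra M ?F
    by standard (rule subalgebra_data)
  \<comment> \<open>Measurability over \<open>M\<close> serves integrability; measurability over the
    data sigma-algebra is what lets the indicators \<open>?R j\<close> be pulled out.\<close>
  note [measurable] = ranking_component_measurable[OF r i data_vector_measurable]
    ranking_component_measurable[OF r i data_vector_measurable_data]
  have RF [measurable]: "?R j \<in> borel_measurable ?F" for j
    by measurable
  have N [measurable]: "?N j \<in> borel_measurable M" for j
  proof (cases "j \<in> ?I")
    case True
    then have [measurable]: "\<theta> j \<in> measurable M (count_space UNIV)"
      by (rule theta_measurable)
    show ?thesis by measurable
  next
    case False
    then show ?thesis by (simp only: if_False) simp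
  qed
  have RN: "integrable M (\<lambda>\<omega>. ?R j \<omega> * ?N j \<omega>)" for j
    by (intro integrable_const_bound[where B = 1] borel_measurable_times N) auto
  \<comment> \<open>Exactly one indicator is 1, because the ranking takes values in the index range.
    This is used for the states and again for the lfdr values.\<close>
  have sum_R: "(\<Sum>j\<in>?I. ?R j \<omega> * g j) = g (r (?X \<omega>) i)" if "\<omega> \<in> space M" for \<omega> and g :: "nat \<Rightarrow> real"
    using ranking_component_in[OF r i that]
    by (simp add: of_bool_def if_distrib[of "\<lambda>x. x * _"] cong: if_cong)
  have eq: "W \<omega> = ?S \<omega>" if "\<omega> \<in> space M" for \<omega>
    using sum_R[OF that, of "\<lambda>j. ?N j \<omega>"] ranking_component_in[OF r i that] by (simp add: W_def)
  have S: "integrable M ?S"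
    by (intro Bochner_Integration.integrable_sum RN)
  then show W: "integrable M W"
    by (subst Bochner_Integration.integrable_cong[OF refl eq])
  have "AE \<omega> in M. real_cond_exp M ?F W \<omega> = real_cond_exp M ?F ?S \<omega>"
    using S W eq by (intro F.real_cond_exp_cong) (auto simp del: sum_mult_of_bool_eq sum_of_bool_mult_eq)
  moreover have "AE \<omega> in M. real_cond_exp M ?F ?S \<omega> =
      (\<Sum>j\<in>?I. real_cond_exp M ?F (\<lambda>\<omega>. ?R j \<omega> * ?N j \<omega>) \<omega>)"
    by (rule F.real_cond_exp_sum) (rule RN)
  moreover have "AE \<omega> in M. \<forall>j\<in>?I. real_cond_exp M ?F (\<lambda>\<omega>. ?R j \<omega> * ?N j \<omega>) \<omega> =
      ?R j \<omega> * real_cond_exp M ?F (?N j) \<omega>"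
    by (intro AE_finite_allI F.real_cond_exp_mult RF N RN) auto
  moreover have "AE \<omega> in M. \<forall>j\<in>?I. real_cond_exp M ?F (?N j) \<omega> = lfdr \<pi> f0 f1 (Z j \<omega>)"
    using real_cond_exp_null_data by (intro AE_finite_allI) auto
  ultimately show "AE \<omega> in M. real_cond_exp M ?F W \<omega> = ordered_lfdr m \<pi> f0 f1 r Z \<omega> i"
    using AE_space
  proof eventually_elim
    case (elim \<omega>)
    have "real_cond_exp M ?F W \<omega> = (\<Sum>j\<in>?I. real_cond_exp M ?F (\<lambda>\<omega>. ?R j \<omega> * ?N j \<omega>) \<omega>)"
      by (rule trans[OF elim(1,2)])
    also have "\<dots> = (\<Sum>j\<in>?I. ?R j \<omega> * lfdr \<pi> f0 f1 (Z j \<omega>))"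
    proof (rule sum.cong[OF refl])
      fix j assume j: "j \<in> ?I"
      show "real_cond_exp M ?F (\<lambda>\<omega>. ?R j \<omega> * ?N j \<omega>) \<omega> = ?R j \<omega> * lfdr \<pi> f0 f1 (Z j \<omega>)"
        unfolding bspec[OF elim(4) j, symmetric] by (rule bspec[OF elim(3) j])
    qed
    also have "\<dots> = ordered_lfdr m \<pi> f0 f1 r Z \<omega> i"
      unfolding ordered_lfdr_def by (rule sum_R[OF elim(5)])
    finally show ?case .
  qed
qed

lemma expected_true_nulls_eq:
  assumes r: "ascending_ranking \<nu> m (lfdr \<pi> f0 f1) r" and k: "k \<le> m"
  shows "AE \<omega> in M. expected_true_nulls M \<nu> m \<theta> r Z \<omega> k =
    (\<Sum>i=1..k. ordered_lfdr m \<pi> f0 f1 r Z \<omega> i)"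
proof -
  let ?F = "data_algebra M \<nu> m Z"
  let ?W = "\<lambda>i \<omega>. 1 - of_bool (\<theta> (r (data_vector m Z \<omega>) i) \<omega>) :: real"
  \<comment> \<open>Again a default 0 for integrability at every index; the sum up to
    \<open>k \<le> m\<close> is not affected.\<close>
  let ?W' = "\<lambda>i \<omega>. if i \<in> {1..m} then ?W i \<omega> else 0"
  interpret F: finite_measure_subalgebra M ?F
    by standard (rule subalgebra_data)
  have "integrable M (?W' i)" for i
    using real_cond_exp_null_ranked(1)[OF r, of i]
    by (cases "i \<in> {1..m}") (simp_all only: if_True if_False integrable_zero)
  then have "AE \<omega> in M. real_cond_exp M ?F (\<lambda>\<omega>. \<Sum>i=1..k. ?W' i \<omega>) \<omega> =
      (\<Sum>i=1..k. real_cond_exp M ?F (?W' i) \<omega>)"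
    by (rule F.real_cond_exp_sum)
  moreover have "(\<lambda>\<omega>. \<Sum>i=1..k. ?W' i \<omega>) = (\<lambda>\<omega>. \<Sum>i=1..k. ?W i \<omega>)"
    using k by (intro ext sum.cong) auto
  moreover have "AE \<omega> in M. \<forall>i\<in>{1..k}. real_cond_exp M ?F (?W' i) \<omega> = ordered_lfdr m \<pi> f0 f1 r Z \<omega> i"
    using real_cond_exp_null_ranked(2)[OF r] k by (intro AE_finite_allI) auto
  ultimately show ?thesis
    unfolding expected_true_nulls_def by (auto elim: eventually_elim2)
qed

end

theorem mainTheorem4:
  fixes M :: "'a measure" and \<nu> :: "'b measure" and m :: nat and \<gamma> \<alpha> \<pi> :: real
    and f0 f1 :: "'b \<Rightarrow> real" and \<theta> :: "nat \<Rightarrow> 'a \<Rightarrow> bool" and Z :: "nat \<Rightarrow> 'a \<Rightarrow> 'b"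
    and r :: "(nat \<Rightarrow> 'b) \<Rightarrow> nat \<Rightarrow> nat"
  assumes "\<gamma> \<in> {0<..<1}" and "\<alpha> \<in> {0<..<1}"
    and "two_group_model M \<nu> m \<pi> f0 f1 \<theta> Z"
    and "ascending_ranking \<nu> m (lfdr \<pi> f0 f1) r"
  defines "T \<equiv> ordered_lfdr m \<pi> f0 f1 r Z"
    and "E \<equiv> expected_true_nulls M \<nu> m \<theta> r Z"
  shows "AE \<omega> in M.
      proc2_K \<gamma> \<alpha> m (E \<omega>) (T \<omega>) = proc1_K \<gamma> \<alpha> m (T \<omega>) \<and>
      rejected r (data_vector m Z \<omega>) (proc2_K \<gamma> \<alpha> m (E \<omega>) (T \<omega>)) =
      rejected r (data_vector m Z \<omega>) (proc1_K \<gamma> \<alpha> m (T \<omega>))"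
proof -
  interpret two_group_model M \<nu> m \<pi> f0 f1 \<theta> Z
    by fact
  have bounds: "0 \<le> T \<omega> i \<and> T \<omega> i \<le> 1" if "i \<in> {1..m}" "\<omega> \<in> space M" for i \<omega>
    using lfdr_bounds measurable_space[OF Z_measurable] that
      ranking_component_in[OF assms(4) that]
    by (simp add: T_def ordered_lfdr_def)
  \<comment> \<open>Conditional expectations are determined only almost surely, separately for each
    \<open>k\<close>; as there are finitely many \<open>k\<close>, one null set serves for all, and
    outside it the deterministic equivalence applies.\<close>
  have "AE \<omega> in M. \<forall>k\<in>{1..m}. E \<omega> k = (\<Sum>i=1..k. T \<omega> i)"
    unfolding T_def E_def using expected_true_nulls_eq[OF assms(4)] by (intro AE_finite_allI) auto
  with AE_space show ?thesis
  proof eventually_elim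
    case (elim \<omega>)
    have "proc2_K \<gamma> \<alpha> m (E \<omega>) (T \<omega>) = proc1_K \<gamma> \<alpha> m (T \<omega>)"
      using assms(1) bounds elim by (intro proc2_K_eq_proc1_K) auto
    then show ?case by simp
  qed
qed

end
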